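(* Let $p\ge 1$ be an integer, let $\alpha,\beta>-1$ be real, and let $\iota\in\mathbb{R}$. Write $J_n=J_n^{(\alpha,\beta)}$ for the Jacobi polynomials, and let $w_{\alpha,\beta}$, $A_p$, $\kappa_p^{(\alpha,\beta)}$ and $\kappa_p^{(\beta,\alpha)}$ be as defined in the context. Assume that $\iota p(p+1)+(p+\alpha+1)(p+\alpha)A_p\neq 0$, $\iota p(p+1)+(p+\beta+1)(p+\beta)A_p\neq 0$, $\kappa_p^{(\alpha,\beta)}\ne 0$ and $\kappa_p^{(\beta,\alpha)}\neq 0$. Define the polynomials of degree at most $p+1$ $$h_L = \frac{(-1)^p}{\kappa_p^{(\alpha,\beta)}}\left(J_{p} -\frac{\iota (p+1)(p+\alpha)J_{p-1} + (p+1)(p+\alpha)A_pJ_{p+1}}{\iota p(p+1) + (p+\alpha+1)(p+\alpha)A_p} \right),$$ $$h_R = \frac{1}{\kappa_p^{(\beta,\alpha)}}\left(J_{p} +\frac{\iota (p+1)(p+\beta)J_{p-1} + (p+1)(p+\beta)A_pJ_{p+1}}{\iota p(p+1) + (p+\beta+1)(p+\beta)A_p} \right).$$ Then $h_L(-1)=1$, $h_L(1)=0$, $h_R(-1)=0$, $h_R(1)=1$, and for every real polynomial $u$ of degree at most $p$ and for both $h=h_L$ and $h=h_R$, $$\int_{-1}^{1} h(\zeta)\,\frac{\mathrm{d}u}{\mathrm{d}\zeta}(\zeta)\,w_{\alpha,\beta}(\zeta)\,\mathrm{d}\zeta-\iota\,\frac{\mathrm{d}^{p}u}{\mathrm{d}\zeta^{p}}\,\frac{\mathrm{d}^{p+1}h}{\mathrm{d}\zeta^{p+1}}\int_{-1}^{1}w_{\alpha,\beta}(\zeta)\,\mathrm{d}\zeta=0$$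 (the derivatives $\mathrm{d}^pu/\mathrm{d}\zeta^p$ and $\mathrm{d}^{p+1}h/\mathrm{d}\zeta^{p+1}$ are constants).
   Context: The weight is $w_{\alpha,\beta}(\zeta)=(1-\zeta)^\alpha(1+\zeta)^\beta$ on $(-1,1)$. $J_n^{(\alpha,\beta)}$ is the classical Jacobi polynomial of degree $n$ with the standard normalisation $J_n^{(\alpha,\beta)}(1)=\frac{(\alpha+1)_n}{n!}$ (so $J_n^{(\alpha,\beta)}(-1)=(-1)^n\frac{(\beta+1)_n}{n!}$), orthogonal with respect to $w_{\alpha,\beta}$. Here $(x)_i=x(x+1)\cdots(x+i-1)$ is the rising Pochhammer symbol, with $(x)_0=1$. Set $$q_n^{(\alpha,\beta)}=\int_{-1}^1\left(J_n^{(\alpha,\beta)}\right)^2w_{\alpha,\beta}\,\mathrm{d}\zeta,\qquad b_n^{(\alpha,\beta)}=\frac{\mathrm{d}^nJ_n^{(\alpha,\beta)}}{\mathrm{d}\zeta^n}=2^{-n}(n+\alpha+\beta+1)_n,$$ $$A_p=\frac{(p+\alpha+\beta+1)\,(p+\alpha+\beta+2)_{p-1}\,q_{p-1}^{(\alpha,\beta)}}{2\,(p+\alpha+\beta)_{p-1}\,b_p^{(\alpha,\beta)}\,b_{p+1}^{(\alpha,\beta)}\,q_0^{(\alpha,\beta)}},$$ which is symmetric in $\alpha$ and $\beta$, and $$\kappa_p^{(\alpha,\beta)}=\frac{(\beta+1)_p}{p!}\left[\left(\frac{p+\alpha}{p+\beta}\right)\frac{\iota p(p+1)+(p+\beta)(p+\beta+1)A_p}{\iota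 p(p+1)+(p+\alpha)(p+\alpha+1)A_p}+1\right],$$ with $\kappa_p^{(\beta,\alpha)}$ obtained by exchanging $\alpha$ and $\beta$. *)

theory Defs
  imports "HOL-Analysis.Analysis" "HOL-Computational_Algebra.Computational_Algebra"
begin

definition jacobi_weight :: "real \<Rightarrow> real \<Rightarrow> real \<Rightarrow> real" where
  "jacobi_weight \<alpha> \<beta> x = (1 - x) powr \<alpha> * (1 + x) powr \<beta>"

(* The classical hypergeometric formula
     J_n(x) = (\<alpha>+1)_n / n! * 2F1(-n, n+\<alpha>+\<beta>+1; \<alpha>+1; (1-x)/2).
   The lemmas below show that for \<alpha>, \<beta> > -1 this is the polynomial of degree n that is
   orthogonal to all polynomials of lower degree with respect to jacobi_weight, normalised
   by its value at 1. *)
definition jacobi_poly :: "real \<Rightarrow> real \<Rightarrow> nat \<Rightarrow> real poly" where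
  "jacobi_poly \<alpha> \<beta> n = smult (pochhammer (\<alpha> + 1) n / fact n)
     (\<Sum>k\<le>n. smult (pochhammer (- real n) k * pochhammer (real n + \<alpha> + \<beta> + 1) k
                     / (fact k * pochhammer (\<alpha> + 1) k))
               ([:1/2, -1/2:] ^ k))"

definition jacobi_q :: "real \<Rightarrow> real \<Rightarrow> nat \<Rightarrow> real" where
  "jacobi_q \<alpha> \<beta> n =
     (LINT x:{-1<..<1}|lborel. (poly (jacobi_poly \<alpha> \<beta> n) x)\<^sup>2 * jacobi_weight \<alpha> \<beta> x)"

(* The n-th derivative of the n-th Jacobi polynomial is constant, so the point of
   evaluation is immaterial. *)
definition jacobi_b :: "real \<Rightarrow> real \<Rightarrow> nat \<Rightarrow> real" where
  "jacobi_b \<alpha> \<beta> n = poly ((pderiv ^^ n) (jacobi_poly \<alpha> \<beta> n)) 0"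

(* The coefficients A, kappa and the functions h_L, h_R are meant for p \<ge> 1 only:
   p - 1 is truncated subtraction. *)
definition coeff_A :: "real \<Rightarrow> real \<Rightarrow> nat \<Rightarrow> real" where
  "coeff_A \<alpha> \<beta> p =
     ((real p + \<alpha> + \<beta> + 1) * pochhammer (real p + \<alpha> + \<beta> + 2) (p - 1) * jacobi_q \<alpha> \<beta> (p - 1)) /
     (2 * pochhammer (real p + \<alpha> + \<beta>) (p - 1) * jacobi_b \<alpha> \<beta> p * jacobi_b \<alpha> \<beta> (p + 1)
        * jacobi_q \<alpha> \<beta> 0)"

definition kappa :: "real \<Rightarrow> real \<Rightarrow> real \<Rightarrow> nat \<Rightarrow> real" where
  "kappa \<iota> \<alpha> \<beta> p = pochhammer (\<beta> + 1) p / fact p *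
     ((real p + \<alpha>) / (real p + \<beta>) *
      ((\<iota> * real p * (real p + 1) + (real p + \<beta>) * (real p + \<beta> + 1) * coeff_A \<alpha> \<beta> p) /
       (\<iota> * real p * (real p + 1) + (real p + \<alpha>) * (real p + \<alpha> + 1) * coeff_A \<alpha> \<beta> p)) + 1)"

definition h_L :: "real \<Rightarrow> real \<Rightarrow> real \<Rightarrow> nat \<Rightarrow> real poly" where
  "h_L \<iota> \<alpha> \<beta> p = smult ((-1) ^ p / kappa \<iota> \<alpha> \<beta> p)
     (jacobi_poly \<alpha> \<beta> p
      - smult (1 / (\<iota> * real p * (real p + 1)
                    + (real p + \<alpha> + 1) * (real p + \<alpha>) * coeff_A \<alpha> \<beta> p))
          (smult (\<iota> * (real p + 1) * (real p + \<alpha>)) (jacobi_poly \<alpha> \<beta> (p - 1))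
           + smult ((real p + 1) * (real p + \<alpha>) * coeff_A \<alpha> \<beta> p) (jacobi_poly \<alpha> \<beta> (p + 1))))"

definition h_R :: "real \<Rightarrow> real \<Rightarrow> real \<Rightarrow> nat \<Rightarrow> real poly" where
  "h_R \<iota> \<alpha> \<beta> p = smult (1 / kappa \<iota> \<beta> \<alpha> p)
     (jacobi_poly \<alpha> \<beta> p
      + smult (1 / (\<iota> * real p * (real p + 1)
                    + (real p + \<beta> + 1) * (real p + \<beta>) * coeff_A \<alpha> \<beta> p))
          (smult (\<iota> * (real p + 1) * (real p + \<beta>)) (jacobi_poly \<alpha> \<beta> (p - 1))
           + smult ((real p + 1) * (real p + \<beta>) * coeff_A \<alpha> \<beta> p) (jacobi_poly \<alpha> \<beta> (p + 1))))"

lemma poly_jacobi_poly: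
  "poly (jacobi_poly \<alpha> \<beta> n) x = pochhammer (\<alpha> + 1) n / fact n *
     (\<Sum>k\<le>n. pochhammer (- real n) k * pochhammer (real n + \<alpha> + \<beta> + 1) k
              / (fact k * pochhammer (\<alpha> + 1) k) * ((1 - x) / 2) ^ k)"
proof -
  have "poly [:1/2, -1/2:] x = (1 - x) / 2"
    by (simp add: field_simps)
  then show ?thesis
    unfolding jacobi_poly_def poly_smult poly_sum poly_power by (simp only:)
qed

lemma poly_jacobi_poly_1: "poly (jacobi_poly \<alpha> \<beta> n) 1 = pochhammer (\<alpha> + 1) n / fact n"
proof -
  have "(\<Sum>k\<le>n. pochhammer (- real n) k * pochhammer (real n + \<alpha> + \<beta> + 1) k
              / (fact k * pochhammer (\<alpha> + 1) k) * ((1 - 1) / 2) ^ k) = (1::real)"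
    by (subst sum.remove[of _ 0]) (auto intro!: sum.neutral simp: power_0_left)
  then show ?thesis
    unfolding poly_jacobi_poly by simp
qed

lemma degree_jacobi_poly_le: "degree (jacobi_poly \<alpha> \<beta> n) \<le> n"
proof -
  have "degree ([:1/2, -1/2:] ^ k :: real poly) \<le> n" if "k \<le> n" for k
    using that by (simp add: degree_power_eq)
  then show ?thesis
    unfolding jacobi_poly_def
    by (intro order.trans[OF degree_smult_le] degree_sum_le) (auto intro: order.trans[OF degree_smult_le])
qed

lemma degree_h_le: "degree (h_L \<iota> \<alpha> \<beta> p) \<le> p + 1" "degree (h_R \<iota> \<alpha> \<beta> p) \<le> p + 1"
proof -
  have "degree (jacobi_poly \<alpha> \<beta> k) \<le> p + 1" if "k \<le> p + 1" for k
    using degree_jacobi_poly_le that by (rule order.trans)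
  then show "degree (h_L \<iota> \<alpha> \<beta> p) \<le> p + 1" "degree (h_R \<iota> \<alpha> \<beta> p) \<le> p + 1"
    unfolding h_L_def h_R_def
    by (intro order.trans[OF degree_smult_le] degree_diff_le degree_add_le; simp)+
qed

lemma coeff_jacobi_poly:
  assumes "\<alpha> > -1"
  shows "coeff (jacobi_poly \<alpha> \<beta> n) n = pochhammer (real n + \<alpha> + \<beta> + 1) n / (2 ^ n * fact n)"
proof -
  have c: "coeff ([:1/2, -1/2:] ^ k :: real poly) n = (if k = n then (-1/2) ^ n else 0)" if "k \<le> n" for k
  proof (cases "k = n")
    case True
    have "lead_coeff ([:1/2, -1/2:] ^ k :: real poly) = (-1/2) ^ k"
      by (subst lead_coeff_power) simp
    then show ?thesis
      using True by (simp add: degree_power_eq)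
  next
    case False
    with that show ?thesis
      by (simp add: coeff_eq_0 degree_power_eq)
  qed
  have m: "pochhammer (- real n) n = (-1) ^ n * fact n"
    by (simp add: pochhammer_same)
  have p: "pochhammer (\<alpha> + 1) n > 0"
    using assms by (intro pochhammer_pos) simp
  have "coeff (jacobi_poly \<alpha> \<beta> n) n = pochhammer (\<alpha> + 1) n / fact n *
     (\<Sum>k\<le>n. if k = n then pochhammer (- real n) k * pochhammer (real n + \<alpha> + \<beta> + 1) k
              / (fact k * pochhammer (\<alpha> + 1) k) * (-1/2) ^ n else 0)"
    unfolding jacobi_poly_def coeff_smult coeff_sum
    by (intro arg_cong2[of _ _ _ _ "(*)"] sum.cong refl) (use c in auto)
  also have "\<dots> = pochhammer (real n + \<alpha> + \<beta> + 1) n * ((-1) ^ n * (-1/2) ^ n) / fact n"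
    using p by (simp add: m)
  also have "(-1) ^ n * (-1/2) ^ n = (1/2 :: real) ^ n"
    by (simp flip: power_mult_distrib)
  also have "pochhammer (real n + \<alpha> + \<beta> + 1) n * (1/2) ^ n / fact n
      = pochhammer (real n + \<alpha> + \<beta> + 1) n / (2 ^ n * fact n)"
    by (simp add: power_divide)
  finally show ?thesis .
qed

lemma pochhammer_jacobi_pos:
  assumes "\<alpha> > -1" "\<beta> > -1"
  shows "pochhammer (real n + \<alpha> + \<beta> + 1) n > 0"
  using assms by (cases n) (auto intro!: pochhammer_pos)

lemma degree_jacobi_poly:
  assumes "\<alpha> > -1" "\<beta> > -1"
  shows "degree (jacobi_poly \<alpha> \<beta> n) = n"
  using coeff_jacobi_poly[OF assms(1), of \<beta> n] pochhammer_jacobi_pos[OF assms, of n]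
    degree_jacobi_poly_le[of \<alpha> \<beta> n] le_degree[of "jacobi_poly \<alpha> \<beta> n" n]
  by simp

lemma jacobi_b_eq:
  assumes "\<alpha> > -1"
  shows "jacobi_b \<alpha> \<beta> n = pochhammer (real n + \<alpha> + \<beta> + 1) n / 2 ^ n"
  unfolding jacobi_b_def
  by (simp add: poly_0_coeff_0 coeff_higher_pderiv coeff_jacobi_poly[OF assms] flip: pochhammer_fact)

lemma jacobi_moment:
  assumes "\<alpha> > -1" "\<beta> > -1"
  shows "set_integrable lborel {-1<..<1} (\<lambda>x. ((1 - x) / 2) ^ k * ((1 + x) / 2) ^ m * jacobi_weight \<alpha> \<beta> x)" (is ?I)
    and "(LINT x:{-1<..<1}|lborel. ((1 - x) / 2) ^ k * ((1 + x) / 2) ^ m * jacobi_weight \<alpha> \<beta> x)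
           = 2 powr (\<alpha> + \<beta> + 1) * Beta (\<alpha> + real k + 1) (\<beta> + real m + 1)" (is ?E)
proof -
  define a b where "a = \<alpha> + real k + 1" and "b = \<beta> + real m + 1"
  have ab: "a > 0" "b > 0"
    using assms by (auto simp: a_def b_def)
  define F where "F t = indicator {0..1} t *\<^sub>R (t powr (b - 1) * (1 - t) powr (a - 1))" for t :: real
  have F: "integrable lborel F" "(LINT t|lborel. F t) = Beta b a"
    using integrable_Beta[OF ab(2,1)] set_borel_integral_eq_integral(2)[OF integrable_Beta[OF ab(2,1)]]
      has_integral_Beta_real[OF ab(2,1)]
    by (simp_all add: F_def[abs_def] set_integrable_def set_lebesgue_integral_def has_integral_iff)
  have eq: "indicator {-1<..<1} x *\<^sub>R (((1 - x) / 2) ^ k * ((1 + x) / 2) ^ m * jacobi_weight \<alpha> \<beta> x)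
          = 2 powr (\<alpha> + \<beta>) * F (1/2 + 1/2 * x)" for x :: real
  proof (cases "x \<in> {-1<..<1}")
    case True
    define s t where "s = (1 - x) / 2" and "t = (1 + x) / 2"
    have st: "s > 0" "t > 0" "1 - x = 2 * s" "1 + x = 2 * t" "1/2 + 1/2 * x = t" "1 - t = s"
      using True by (auto simp: s_def t_def field_simps)
    have "s ^ k * t ^ m * ((2 * s) powr \<alpha> * (2 * t) powr \<beta>)
            = 2 powr (\<alpha> + \<beta>) * (t powr (b - 1) * s powr (a - 1))"
      using st(1,2) by (simp add: a_def b_def powr_mult powr_add powr_realpow mult_ac)
    moreover have "t \<in> {0..1}"
      using st by auto
    ultimately show ?thesis
      using True
      unfolding F_def jacobi_weight_def s_def[symmetric] t_def[symmetric] st(3-6)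
      by simp
  next
    case False
    then have "F (1/2 + 1/2 * x) = 0"
      by (cases "x = 1 \<or> x = -1") (auto simp: F_def indicator_def)
    with False show ?thesis by simp
  qed
  have i: "integrable lborel (\<lambda>x. F (1/2 + 1/2 * x))"
    using F(1) by (rule lborel_integrable_real_affine) simp
  show ?I
    unfolding set_integrable_def eq using i by simp
  have "(LINT x|lborel. F (1/2 + 1/2 * x)) = 2 * Beta b a"
    using F(2) lborel_integral_real_affine[of "1/2" F "1/2"] by simp
  then show ?E
    unfolding set_lebesgue_integral_def eq
    by (simp add: a_def b_def Beta_commute powr_add)
qed

lemma jacobi_weight_integrable:
  assumes "\<alpha> > -1" "\<beta> > -1"
  shows "set_integrable lborel {-1<..<1} (\<lambda>x. poly P x * jacobi_weight \<alpha> \<beta> x)"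
proof -
  define c where "c i = coeff (pcompose P [:-1, 2:]) i" for i
  define N where "N = degree (pcompose P [:-1, 2:])"
  have "poly P x = (\<Sum>i\<le>N. c i * ((1 + x) / 2) ^ i)" for x
  proof -
    have "poly P x = poly (pcompose P [:-1, 2:]) ((1 + x) / 2)"
      by (simp add: poly_pcompose field_simps)
    then show ?thesis
      by (simp add: poly_altdef c_def N_def)
  qed
  then have eq: "poly P x * jacobi_weight \<alpha> \<beta> x
      = (\<Sum>i\<le>N. c i * (((1 - x) / 2) ^ 0 * ((1 + x) / 2) ^ i * jacobi_weight \<alpha> \<beta> x))" for x
    by (simp add: sum_distrib_right mult.assoc)
  show ?thesis
    using jacobi_moment(1)[OF assms, of 0]
    unfolding eq set_integrable_def scaleR_sum_right
    by (intro Bochner_Integration.integrable_sum) (simp add: mult.left_commute)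
qed

lemma jacobi_poly_orthogonal_power:
  assumes "\<alpha> > -1" "\<beta> > -1" "m < n"
  shows "(LINT x:{-1<..<1}|lborel. poly (jacobi_poly \<alpha> \<beta> n) x * ((1 + x) / 2) ^ m * jacobi_weight \<alpha> \<beta> x) = 0"
proof -
  define r where "r k = pochhammer (- real n) k * pochhammer (real n + \<alpha> + \<beta> + 1) k
              / (fact k * pochhammer (\<alpha> + 1) k)" for k
  define B where "B = Gamma (\<alpha> + 1) * Gamma (\<beta> + real m + 1) / Gamma (\<alpha> + \<beta> + real m + 2)"
  define c where "c = \<alpha> + \<beta> + real m + 2"
  have c: "c > 0"
    using assms by (simp add: c_def)
  have beta: "Beta (\<alpha> + real k + 1) (\<beta> + real m + 1) = B * (pochhammer (\<alpha> + 1) k / pochhammer c k)" for k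
  proof -
    have ni: "\<alpha> + 1 \<notin> \<int>\<^sub>\<le>\<^sub>0" "c \<notin> \<int>\<^sub>\<le>\<^sub>0"
      using assms c by (auto elim!: nonpos_Ints_cases)
    have g: "Gamma (\<alpha> + 1) > 0" "Gamma c > 0" "Gamma (c + real k) > 0"
      using assms c by (auto intro!: Gamma_real_pos)
    have s: "\<alpha> + real k + 1 + (\<beta> + real m + 1) = c + real k" "\<alpha> + real k + 1 = \<alpha> + 1 + real k"
      "\<alpha> + \<beta> + real m + 2 = c"
      by (simp_all add: c_def)
    show ?thesis
      unfolding Beta_def B_def s(1,3) unfolding s(2)
        pochhammer_Gamma[OF ni(1)] pochhammer_Gamma[OF ni(2)]
      using g by simp
  qed
  have pos: "pochhammer (\<alpha> + 1) k > 0" for k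
    using assms by (intro pochhammer_pos) simp
  have "(\<Sum>k\<le>n. r k * Beta (\<alpha> + real k + 1) (\<beta> + real m + 1))
      = B * (\<Sum>k = 0..n. pochhammer (real n + \<alpha> + \<beta> + 1) k * pochhammer (- real n) k
               / (of_nat (fact k) * pochhammer c k))"
    unfolding sum_distrib_left
  proof (rule sum.cong)
    fix k
    show "r k * Beta (\<alpha> + real k + 1) (\<beta> + real m + 1) =
        B * (pochhammer (real n + \<alpha> + \<beta> + 1) k * pochhammer (- real n) k
               / (of_nat (fact k) * pochhammer c k))"
      unfolding beta r_def using pos[of k] by (simp add: field_simps)
  qed auto
  also have "\<dots> = B * (pochhammer (c - (real n + \<alpha> + \<beta> + 1)) n / pochhammer c n)"
    using c by (subst Vandermonde_pochhammer) auto
  also have "c - (real n + \<alpha> + \<beta> + 1) = - real (n - m - 1)"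
    using assms(3) by (simp add: c_def of_nat_diff)
  also have "pochhammer (- real (n - m - 1)) n = 0"
    using assms(3) by (subst pochhammer_of_nat_eq_0_iff) simp
  finally have sum0: "(\<Sum>k\<le>n. r k * Beta (\<alpha> + real k + 1) (\<beta> + real m + 1)) = 0"
    by simp
  define K where "K = pochhammer (\<alpha> + 1) n / fact n"
  have eq: "poly (jacobi_poly \<alpha> \<beta> n) x * ((1 + x) / 2) ^ m * jacobi_weight \<alpha> \<beta> x
      = (\<Sum>k\<le>n. (K * r k) * (((1 - x) / 2) ^ k * ((1 + x) / 2) ^ m * jacobi_weight \<alpha> \<beta> x))" for x
    by (simp add: poly_jacobi_poly sum_distrib_left sum_distrib_right K_def r_def mult_ac)
  have "(LINT x:{-1<..<1}|lborel. poly (jacobi_poly \<alpha> \<beta> n) x * ((1 + x) / 2) ^ m * jacobi_weight \<alpha> \<beta> x)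
      = (\<Sum>k\<le>n. (K * r k) * (2 powr (\<alpha> + \<beta> + 1) * Beta (\<alpha> + real k + 1) (\<beta> + real m + 1)))"
    unfolding eq using jacobi_moment[OF assms(1,2)]
    unfolding set_integrable_def set_lebesgue_integral_def scaleR_sum_right
    by (subst Bochner_Integration.integral_sum) (auto simp: mult.left_commute)
  also have "\<dots> = K * 2 powr (\<alpha> + \<beta> + 1) * (\<Sum>k\<le>n. r k * Beta (\<alpha> + real k + 1) (\<beta> + real m + 1))"
    by (simp add: sum_distrib_left mult_ac)
  finally show ?thesis
    using sum0 by simp
qed

lemma jacobi_poly_orthogonal:
  assumes "\<alpha> > -1" "\<beta> > -1" "degree Q < n"
  shows "(LINT x:{-1<..<1}|lborel. poly (jacobi_poly \<alpha> \<beta> n) x * poly Q x * jacobi_weight \<alpha> \<beta> x) = 0"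
proof -
  define c where "c i = coeff (pcompose Q [:-1, 2:]) i" for i
  define N where "N = degree (pcompose Q [:-1, 2:])"
  have N: "N < n"
    using assms(3) by (simp add: N_def degree_pcompose)
  have "poly Q x = (\<Sum>i\<le>N. c i * ((1 + x) / 2) ^ i)" for x
  proof -
    have "poly Q x = poly (pcompose Q [:-1, 2:]) ((1 + x) / 2)"
      by (simp add: poly_pcompose field_simps)
    then show ?thesis
      by (simp add: poly_altdef c_def N_def)
  qed
  then have eq: "poly (jacobi_poly \<alpha> \<beta> n) x * poly Q x * jacobi_weight \<alpha> \<beta> x
      = (\<Sum>i\<le>N. c i * (poly (jacobi_poly \<alpha> \<beta> n) x * ((1 + x) / 2) ^ i * jacobi_weight \<alpha> \<beta> x))" for x
    by (simp add: sum_distrib_left sum_distrib_right mult_ac)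
  have int: "set_integrable lborel {-1<..<1}
      (\<lambda>x. poly (jacobi_poly \<alpha> \<beta> n) x * ((1 + x) / 2) ^ i * jacobi_weight \<alpha> \<beta> x)" for i
    using jacobi_weight_integrable[OF assms(1,2), of "jacobi_poly \<alpha> \<beta> n * [:1/2, 1/2:] ^ i"]
    by (simp add: poly_power add_divide_distrib)
  show ?thesis
    using N int jacobi_poly_orthogonal_power[OF assms(1,2)]
    unfolding eq set_integrable_def set_lebesgue_integral_def scaleR_sum_right
    by (subst Bochner_Integration.integral_sum) (auto simp: mult.left_commute)
qed

end

theory Submission
  imports Defs
begin

text \<open>
  Since \<open>u'\<close> has degree at most \<open>p - 1\<close>, orthogonality kills the contributions of \<open>J\<^sub>p\<close> and
  \<open>J\<^sub>p\<^sub>+\<^sub>1\<close> to the integral of \<open>h u'\<close>, and only the leading coefficient of \<open>u'\<close> matters for the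
  contribution of \<open>J\<^sub>p\<^sub>-\<^sub>1\<close>. Likewise only \<open>J\<^sub>p\<^sub>+\<^sub>1\<close> contributes to the derivative of \<open>h\<close> of order
  \<open>p + 1\<close>. The two terms cancel because \<open>A\<^sub>p\<close> is, in disguise, \<open>q\<^sub>p\<^sub>-\<^sub>1 / (b\<^sub>p\<^sub>-\<^sub>1 b\<^sub>p\<^sub>+\<^sub>1 q\<^sub>0)\<close>. The
  boundary values come from the reflection formula for Jacobi polynomials, which follows from
  orthogonality and a comparison of leading coefficients.
\<close>

section \<open>The weighted integral as a definite linear functional on polynomials\<close>

definition jacobi_integral :: "real \<Rightarrow> real \<Rightarrow> real poly \<Rightarrow> real" where
  "jacobi_integral \<alpha> \<beta> P = (LINT x:{-1<..<1}|lborel. poly P x * jacobi_weight \<alpha> \<beta> x)"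

lemma jacobi_integral_smult: "jacobi_integral \<alpha> \<beta> (smult c P) = c * jacobi_integral \<alpha> \<beta> P"
  unfolding jacobi_integral_def by (simp add: mult.assoc)

lemma jacobi_integral_add:
  assumes "\<alpha> > -1" "\<beta> > -1"
  shows "jacobi_integral \<alpha> \<beta> (P + Q) = jacobi_integral \<alpha> \<beta> P + jacobi_integral \<alpha> \<beta> Q"
  using set_integral_add(2)[OF jacobi_weight_integrable[OF assms, of P] jacobi_weight_integrable[OF assms, of Q]]
  unfolding jacobi_integral_def by (simp add: distrib_right)

lemma jacobi_integral_diff:
  assumes "\<alpha> > -1" "\<beta> > -1"
  shows "jacobi_integral \<alpha> \<beta> (P - Q) = jacobi_integral \<alpha> \<beta> P - jacobi_integral \<alpha> \<beta> Q"
  using set_integral_diff(2)[OF jacobi_weight_integrable[OF assms, of P] jacobi_weight_integrable[OF assms, of Q]]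
  unfolding jacobi_integral_def by (simp add: left_diff_distrib)

lemma jacobi_integral_jacobi_poly_mult:
  assumes "\<alpha> > -1" "\<beta> > -1" "degree Q < n"
  shows "jacobi_integral \<alpha> \<beta> (jacobi_poly \<alpha> \<beta> n * Q) = 0"
  using jacobi_poly_orthogonal[OF assms] by (simp add: jacobi_integral_def)

lemma jacobi_q_eq_integral:
  "jacobi_q \<alpha> \<beta> n = jacobi_integral \<alpha> \<beta> (jacobi_poly \<alpha> \<beta> n * jacobi_poly \<alpha> \<beta> n)"
  by (simp add: jacobi_q_def jacobi_integral_def power2_eq_square)

text \<open>The substitution of -x for x preserves (-1,1) and swaps the two factors of the
  weight.\<close>

lemma jacobi_integral_pcompose_minus:
  "jacobi_integral \<alpha> \<beta> (pcompose P [:0, -1:]) = jacobi_integral \<beta> \<alpha> P"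
proof -
  define f where "f x = indicator {-1<..<1} x *\<^sub>R (poly P x * jacobi_weight \<beta> \<alpha> x)" for x
  have "integral\<^sup>L lborel f = (LINT x|lborel. f (0 + (-1) * x))"
    using lborel_integral_real_affine[of "-1" f 0] by simp
  also have "\<dots> = (LINT x:{-1<..<1}|lborel. poly (pcompose P [:0, -1:]) x * jacobi_weight \<alpha> \<beta> x)"
    unfolding set_lebesgue_integral_def f_def
    by (intro Bochner_Integration.integral_cong)
       (auto simp: indicator_def poly_pcompose jacobi_weight_def mult_ac)
  finally show ?thesis
    unfolding jacobi_integral_def set_lebesgue_integral_def f_def by (rule sym)
qed

text \<open>A nonnegative integrand with integral zero vanishes almost everywhere. The weight is
  positive on (-1,1) and a nonzero polynomial has only finitely many roots, so otherwise the
  interval would be a null set.\<close>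

lemma jacobi_integral_square_eq_0D:
  assumes "\<alpha> > -1" "\<beta> > -1" "jacobi_integral \<alpha> \<beta> (P * P) = 0"
  shows "P = 0"
proof (rule ccontr)
  assume "P \<noteq> 0"
  define f where "f x = indicator {-1<..<1} x *\<^sub>R (poly (P * P) x * jacobi_weight \<alpha> \<beta> x)" for x
  have "integrable lborel f" "integral\<^sup>L lborel f = 0"
    using jacobi_weight_integrable[OF assms(1,2), of "P * P"] assms(3)
    by (simp_all add: f_def[abs_def] set_integrable_def jacobi_integral_def set_lebesgue_integral_def)
  moreover have "AE x in lborel. f x \<ge> 0"
    by (simp add: f_def jacobi_weight_def)
  ultimately have "AE x in lborel. f x = 0"
    using integral_nonneg_eq_0_iff_AE by blast
  moreover have "AE x in lborel. x \<notin> {x. poly P x = 0}"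
    using poly_roots_finite[OF \<open>P \<noteq> 0\<close>] by (intro AE_not_in finite_imp_null_set_lborel)
  ultimately have "AE x in lborel. x \<notin> {-1<..<1::real}"
    by eventually_elim (auto simp: f_def jacobi_weight_def)
  then have "emeasure lborel {-1<..<1::real} = 0"
    by (subst (asm) AE_iff_measurable[of "{-1<..<1}"]) auto
  then show False
    by simp
qed

section \<open>Reflection and the symmetry in \<alpha> and \<beta>\<close>

lemma degree_diff_less_of_coeff_eq:
  fixes P Q :: "'a::ab_group_add poly"
  assumes "degree P \<le> n" "degree Q \<le> n" "coeff P n = coeff Q n"
  shows "P = Q \<or> degree (P - Q) < n"
\<comment> \<open>Equality has to be a separate alternative: the zero polynomial has degree 0, which
  is not below \<open>n\<close> when \<open>n = 0\<close>.\<close>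
proof (cases "P = Q")
  case False
  have "degree (P - Q) \<le> n"
    using assms by (intro degree_diff_le)
  moreover have "degree (P - Q) \<noteq> n"
    using assms(3) False leading_coeff_0_iff[of "P - Q"] by auto
  ultimately show ?thesis by simp
qed simp

text \<open>Both sides have degree \<open>n\<close> and the same leading coefficient, so their
  difference \<open>D\<close> has smaller degree. Both are orthogonal to \<open>D\<close>, hence
  \<open>D\<close> is orthogonal to itself and must vanish.\<close>

lemma jacobi_poly_reflect:
  assumes "\<alpha> > -1" "\<beta> > -1"
  shows "pcompose (jacobi_poly \<beta> \<alpha> n) [:0, -1:] = smult ((-1) ^ n) (jacobi_poly \<alpha> \<beta> n)"
proof -
  define R where "R = pcompose (jacobi_poly \<beta> \<alpha> n) [:0, -1:]"
  define J where "J = smult ((-1) ^ n) (jacobi_poly \<alpha> \<beta> n)"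
  have dR: "degree R = n"
    using degree_jacobi_poly[OF assms(2,1)] by (simp add: R_def degree_pcompose)
  have "coeff R n = lead_coeff (jacobi_poly \<beta> \<alpha> n) * (-1) ^ n"
    using lead_coeff_comp[of "[:0, -1::real:]" "jacobi_poly \<beta> \<alpha> n"] dR degree_jacobi_poly[OF assms(2,1), of n]
    by (simp add: R_def)
  \<comment> \<open>The leading coefficient depends on \<alpha> and \<beta> only through their sum,
    so exchanging them leaves it unchanged.\<close>
  also have "\<dots> = coeff J n"
    by (simp add: J_def degree_jacobi_poly[OF assms(2,1)] coeff_jacobi_poly assms add_ac)
  finally have "coeff R n = coeff J n" .
  then consider "R = J" | "degree (R - J) < n"
    using degree_diff_less_of_coeff_eq[of R n J] dR degree_jacobi_poly_le by (auto simp: J_def)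
  then have "R = J"
  proof cases
    case 2
    define D where "D = R - J"
    have d: "degree D < n"
      using 2 by (simp add: D_def)
    \<comment> \<open>Reflection is an involution, so \<open>R * D\<close> is the reflection of
      \<open>jacobi_poly \<beta> \<alpha> n * D'\<close>. Its integral thus moves to the exchanged
      weight, where orthogonality is available.\<close>
    define D' where "D' = pcompose D [:0, -1:]"
    have D': "D = pcompose D' [:0, -1:]"
      unfolding D'_def by (simp flip: pcompose_assoc add: pcompose_pCons)
    have "degree D' < n"
      using d by (simp add: D'_def degree_pcompose)
    then have "jacobi_integral \<alpha> \<beta> (R * D) = 0"
      using jacobi_integral_pcompose_minus[of \<alpha> \<beta> "jacobi_poly \<beta> \<alpha> n * D'"]
        jacobi_integral_jacobi_poly_mult[OF assms(2,1), of D' n]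
      by (subst D') (simp add: R_def pcompose_mult)
    moreover have "jacobi_integral \<alpha> \<beta> (J * D) = 0"
      using jacobi_integral_jacobi_poly_mult[OF assms d] by (simp add: J_def jacobi_integral_smult)
    ultimately have "jacobi_integral \<alpha> \<beta> (D * D) = 0"
      using jacobi_integral_diff[OF assms, of "R * D" "J * D"] by (simp add: D_def algebra_simps)
    then show ?thesis
      using jacobi_integral_square_eq_0D[OF assms, of D] by (simp add: D_def)
  qed
  then show ?thesis by (simp add: R_def J_def)
qed

lemma poly_jacobi_poly_minus_1:
  assumes "\<alpha> > -1" "\<beta> > -1"
  shows "poly (jacobi_poly \<alpha> \<beta> n) (-1) = (-1) ^ n * (pochhammer (\<beta> + 1) n / fact n)"
  using arg_cong[OF jacobi_poly_reflect[OF assms(2,1), of n], of "\<lambda>P. poly P 1"]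
  by (simp add: poly_pcompose poly_jacobi_poly_1)

lemma jacobi_q_commute:
  assumes "\<alpha> > -1" "\<beta> > -1"
  shows "jacobi_q \<alpha> \<beta> n = jacobi_q \<beta> \<alpha> n"
proof -
  have "jacobi_q \<beta> \<alpha> n = jacobi_integral \<alpha> \<beta> (pcompose (jacobi_poly \<beta> \<alpha> n * jacobi_poly \<beta> \<alpha> n) [:0, -1:])"
    by (simp only: jacobi_q_eq_integral jacobi_integral_pcompose_minus)
  then show ?thesis
    by (simp add: pcompose_mult jacobi_poly_reflect[OF assms] jacobi_integral_smult jacobi_q_eq_integral
        flip: power_mult_distrib)
qed

text \<open>The b's depend only on the sum of the parameters, and the q's are invariant under
  reflection. This is needed because \<open>kappa \<iota> \<beta> \<alpha> p\<close> contains
  \<open>coeff_A \<beta> \<alpha> p\<close>, whereas \<open>h_R\<close> is built from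
  \<open>coeff_A \<alpha> \<beta> p\<close>.\<close>

lemma coeff_A_commute:
  assumes "\<alpha> > -1" "\<beta> > -1"
  shows "coeff_A \<alpha> \<beta> p = coeff_A \<beta> \<alpha> p"
  by (simp add: coeff_A_def jacobi_b_eq jacobi_q_commute[OF assms] assms add_ac)

section \<open>The constants q, b and A, and the correction identity\<close>

lemma jacobi_integral_jacobi_poly_mult_degree_le:
  assumes "\<alpha> > -1" "\<beta> > -1" "degree v \<le> n"
  shows "jacobi_integral \<alpha> \<beta> (jacobi_poly \<alpha> \<beta> n * v) = fact n * coeff v n * jacobi_q \<alpha> \<beta> n / jacobi_b \<alpha> \<beta> n"
proof -
  let ?J = "jacobi_poly \<alpha> \<beta> n"
  have lc: "coeff ?J n = jacobi_b \<alpha> \<beta> n / fact n" "jacobi_b \<alpha> \<beta> n > 0"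
    using assms pochhammer_jacobi_pos[OF assms(1,2), of n] by (simp_all add: coeff_jacobi_poly jacobi_b_eq)
  \<comment> \<open>Chosen so that \<open>smult k ?J\<close> and \<open>v\<close> agree in degree
    \<open>n\<close>; the remainder is orthogonal to \<open>?J\<close>, which leaves only
    \<open>k\<close> times the square norm.\<close>
  define k where "k = fact n * coeff v n / jacobi_b \<alpha> \<beta> n"
  have "v = smult k ?J \<or> degree (v - smult k ?J) < n"
    using lc assms(3) degree_jacobi_poly_le[of \<alpha> \<beta> n]
    by (intro degree_diff_less_of_coeff_eq) (auto simp: k_def intro: order.trans[OF degree_smult_le])
  then have "jacobi_integral \<alpha> \<beta> (?J * (v - smult k ?J)) = 0"
  proof
    assume "v = smult k ?J"
    then show ?thesis by (simp add: jacobi_integral_def)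
  qed (rule jacobi_integral_jacobi_poly_mult[OF assms(1,2)])
  then have "jacobi_integral \<alpha> \<beta> (?J * v) = k * jacobi_q \<alpha> \<beta> n"
    by (simp add: right_diff_distrib jacobi_integral_diff[OF assms(1,2)] jacobi_integral_smult jacobi_q_eq_integral)
  then show ?thesis
    by (simp add: k_def)
qed

lemma higher_pderiv_degree_le:
  fixes u :: "real poly"
  assumes "degree u \<le> n"
  shows "(pderiv ^^ n) u = [:fact n * coeff u n:]"
proof (rule poly_eqI)
  fix i
  show "coeff ((pderiv ^^ n) u) i = coeff [:fact n * coeff u n:] i"
    using assms by (cases i) (simp_all add: coeff_higher_pderiv coeff_eq_0 flip: pochhammer_fact)
qed

lemma jacobi_q_0:
  "jacobi_q \<alpha> \<beta> 0 = (LINT x:{-1<..<1}|lborel. jacobi_weight \<alpha> \<beta> x)"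
  by (simp add: jacobi_q_def jacobi_poly_def)

lemma jacobi_q_0_pos:
  assumes "\<alpha> > -1" "\<beta> > -1"
  shows "jacobi_q \<alpha> \<beta> 0 > 0"
proof -
  have "Beta (\<alpha> + 1) (\<beta> + 1) > 0"
    using assms by (simp add: Beta_def Gamma_real_pos)
  then show ?thesis
    using jacobi_moment(2)[OF assms, of 0 0] by (simp add: jacobi_q_0)
qed

lemma jacobi_b_pos:
  assumes "\<alpha> > -1" "\<beta> > -1"
  shows "jacobi_b \<alpha> \<beta> n > 0"
  using assms pochhammer_jacobi_pos[OF assms] by (simp add: jacobi_b_eq)

text \<open>Up to powers of 2, the Pochhammer factors in the numerator and denominator of
  \<open>coeff_A\<close> are b_p and b_{p-1}; b_p then cancels. The left side is the product that
  arises from the derivative of order p+1 of h and the total mass of the weight.\<close>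

lemma coeff_A_eq:
  assumes "p \<ge> 1" "\<alpha> > -1" "\<beta> > -1"
  shows "coeff_A \<alpha> \<beta> p * jacobi_b \<alpha> \<beta> (p + 1) * jacobi_q \<alpha> \<beta> 0
    = jacobi_q \<alpha> \<beta> (p - 1) / jacobi_b \<alpha> \<beta> (p - 1)"
proof -
  obtain m where m: "p = Suc m"
    using assms(1) by (cases p) auto
  let ?s = "real p + \<alpha> + \<beta>"
  have "jacobi_b \<alpha> \<beta> p = (?s + 1) * pochhammer (?s + 2) m / 2 ^ p"
    by (simp add: jacobi_b_eq assms m pochhammer_rec add_ac)
  then have b: "(?s + 1) * pochhammer (?s + 2) m = 2 ^ p * jacobi_b \<alpha> \<beta> p"
    by simp
  have "jacobi_b \<alpha> \<beta> m = pochhammer ?s m / 2 ^ m"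
    by (simp add: jacobi_b_eq assms m add_ac)
  then have b': "pochhammer ?s m = 2 ^ m * jacobi_b \<alpha> \<beta> m"
    by simp
  have "coeff_A \<alpha> \<beta> p = 2 ^ p * jacobi_b \<alpha> \<beta> p * jacobi_q \<alpha> \<beta> m /
      (2 * (2 ^ m * jacobi_b \<alpha> \<beta> m) * jacobi_b \<alpha> \<beta> p * jacobi_b \<alpha> \<beta> (p + 1) * jacobi_q \<alpha> \<beta> 0)"
    unfolding coeff_A_def b[symmetric] b'[symmetric] by (simp add: m)
  then show ?thesis
    using jacobi_b_pos[OF assms(2,3), of p] jacobi_b_pos[OF assms(2,3), of "p + 1"]
      jacobi_b_pos[OF assms(2,3), of m] jacobi_q_0_pos[OF assms(2,3)]
    by (simp add: m)
qed

text \<open>A common form of \<open>h_L\<close> and \<open>h_R\<close>. The identity depends only on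
  the ratio of \<iota> to \<open>coeff_A \<alpha> \<beta> p\<close> between the two neighbours of
  J_p: both terms carry the factor \<open>c * d * e\<close>, so they cancel for every choice of
  these, and the actual values serve the boundary conditions.\<close>

lemma jacobi_correction_identity:
  fixes c d e \<iota> \<alpha> \<beta> :: real and p :: nat
  defines "h \<equiv> smult c (jacobi_poly \<alpha> \<beta> p + smult d (smult (\<iota> * e) (jacobi_poly \<alpha> \<beta> (p - 1))
      + smult (e * coeff_A \<alpha> \<beta> p) (jacobi_poly \<alpha> \<beta> (p + 1))))"
  assumes p: "p \<ge> 1" and ab: "\<alpha> > -1" "\<beta> > -1" and u: "degree u \<le> p"
  shows "(LINT x:{-1<..<1}|lborel. poly h x * poly (pderiv u) x * jacobi_weight \<alpha> \<beta> x)
      - \<iota> * poly ((pderiv ^^ p) u) \<xi> * poly ((pderiv ^^ (p + 1)) h) \<eta>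
          * (LINT x:{-1<..<1}|lborel. jacobi_weight \<alpha> \<beta> x) = 0"
proof -
  let ?J = "jacobi_poly \<alpha> \<beta>" and ?I = "jacobi_integral \<alpha> \<beta>"
  have du: "degree (pderiv u) \<le> p - 1"
    using u by (simp add: degree_pderiv)
  have I0: "?I (?J n * pderiv u) = 0" if "n \<ge> p" for n
    using that du p by (intro jacobi_integral_jacobi_poly_mult ab) simp
  \<comment> \<open>Both sides are the constant p-th derivative of \<open>u\<close>, the left one
    read as the derivative of order p-1 of \<open>pderiv u\<close>.\<close>
  have "fact (p - 1) * coeff (pderiv u) (p - 1) = fact p * coeff u p"
    using p by (cases p) (simp_all add: coeff_pderiv algebra_simps)
  then have I1: "?I (?J (p - 1) * pderiv u)
      = fact p * coeff u p * (coeff_A \<alpha> \<beta> p * jacobi_b \<alpha> \<beta> (p + 1) * jacobi_q \<alpha> \<beta> 0)"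
    using jacobi_integral_jacobi_poly_mult_degree_le[OF ab du] coeff_A_eq[OF p ab] by simp
  have "(LINT x:{-1<..<1}|lborel. poly h x * poly (pderiv u) x * jacobi_weight \<alpha> \<beta> x) = ?I (h * pderiv u)"
    by (simp add: jacobi_integral_def)
  also have "h * pderiv u = smult c (?J p * pderiv u + smult d (smult (\<iota> * e) (?J (p - 1) * pderiv u)
      + smult (e * coeff_A \<alpha> \<beta> p) (?J (p + 1) * pderiv u)))"
    by (simp only: h_def mult_smult_left distrib_right)
  also have "?I \<dots> = c * d * \<iota> * e * ?I (?J (p - 1) * pderiv u)"
    by (simp add: jacobi_integral_smult jacobi_integral_add[OF ab] I0)
  finally have lhs: "(LINT x:{-1<..<1}|lborel. poly h x * poly (pderiv u) x * jacobi_weight \<alpha> \<beta> x)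
      = c * d * \<iota> * e * ?I (?J (p - 1) * pderiv u)" .
  have deg: "degree (?J n) \<le> p + 1" if "n \<le> p + 1" for n
    using degree_jacobi_poly_le that by (rule order.trans)
  have "degree h \<le> p + 1"
    unfolding h_def by (intro order.trans[OF degree_smult_le] degree_add_le deg; simp)
  moreover have "coeff (?J n) (p + 1) = 0" if "n < p + 1" for n
    using that degree_jacobi_poly_le[of \<alpha> \<beta> n] by (intro coeff_eq_0) simp
  then have "coeff h (p + 1) = c * d * e * coeff_A \<alpha> \<beta> p * coeff (?J (p + 1)) (p + 1)"
    by (simp add: h_def)
  moreover have "jacobi_b \<alpha> \<beta> (p + 1) = fact (p + 1) * coeff (?J (p + 1)) (p + 1)"
    using ab by (simp only: jacobi_b_eq coeff_jacobi_poly) simp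
  ultimately have "(pderiv ^^ (p + 1)) h = [:c * d * e * coeff_A \<alpha> \<beta> p * jacobi_b \<alpha> \<beta> (p + 1):]"
    using higher_pderiv_degree_le[of h "p + 1"] by (simp add: mult_ac)
  then have "poly ((pderiv ^^ (p + 1)) h) \<eta> = c * d * e * coeff_A \<alpha> \<beta> p * jacobi_b \<alpha> \<beta> (p + 1)"
    by simp
  then show ?thesis
    unfolding lhs I1 jacobi_q_0[symmetric] higher_pderiv_degree_le[OF u] by simp
qed

section \<open>Boundary values\<close>

lemma pochhammer_div_fact_neighbours:
  fixes \<alpha> :: real
  assumes "p \<ge> 1" "real p + \<alpha> \<noteq> 0"
  shows "pochhammer (\<alpha> + 1) (p - 1) / fact (p - 1)
      = pochhammer (\<alpha> + 1) p / fact p * (real p / (real p + \<alpha>))"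
    and "pochhammer (\<alpha> + 1) (p + 1) / fact (p + 1)
      = pochhammer (\<alpha> + 1) p / fact p * ((real p + \<alpha> + 1) / (real p + 1))"
proof -
  obtain m where m: "p = Suc m"
    using assms(1) by (cases p) auto
  show "pochhammer (\<alpha> + 1) (p - 1) / fact (p - 1)
      = pochhammer (\<alpha> + 1) p / fact p * (real p / (real p + \<alpha>))"
    using assms(2) by (simp add: m pochhammer_Suc divide_simps)
  show "pochhammer (\<alpha> + 1) (p + 1) / fact (p + 1)
      = pochhammer (\<alpha> + 1) p / fact p * ((real p + \<alpha> + 1) / (real p + 1))"
    by (simp add: pochhammer_Suc divide_simps add_ac)
qed

text \<open>Writing the endpoint values of degrees p-1 and p+1 as multiples of the one of degree p
  lets that value be factored out. With equal parameters the quotient is 1, which produces the zero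
  at one endpoint; with distinct roles it is the first summand of \<open>kappa\<close>, which
  produces the value 1 at the other.\<close>

lemma boundary_bracket:
  fixes \<alpha> \<beta> \<iota> A :: real
  assumes "p \<ge> 1" "real p + \<alpha> \<noteq> 0" "real p + \<beta> \<noteq> 0"
    and D: "\<iota> * real p * (real p + 1) + (real p + \<alpha> + 1) * (real p + \<alpha>) * A \<noteq> 0" (is "?D \<noteq> 0")
  shows "1 / ?D * (\<iota> * (real p + 1) * (real p + \<alpha>) * (pochhammer (\<beta> + 1) (p - 1) / fact (p - 1))
      + (real p + 1) * (real p + \<alpha>) * A * (pochhammer (\<beta> + 1) (p + 1) / fact (p + 1)))
    = pochhammer (\<beta> + 1) p / fact p * ((real p + \<alpha>) / (real p + \<beta>) *
      ((\<iota> * real p * (real p + 1) + (real p + \<beta>) * (real p + \<beta> + 1) * A) /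
       (\<iota> * real p * (real p + 1) + (real p + \<alpha>) * (real p + \<alpha> + 1) * A)))"
proof -
  have D': "\<iota> * real p * (real p + 1) + (real p + \<alpha>) * (real p + \<alpha> + 1) * A = ?D"
    by (simp add: mult_ac)
  define P where "P = pochhammer (\<beta> + 1) p / fact p"
  have "real p + 1 \<noteq> 0" by linarith
  then show ?thesis
    using D assms(3)
    unfolding D' pochhammer_div_fact_neighbours[OF assms(1,3)] P_def[symmetric]
    by (simp add: divide_simps) (simp add: algebra_simps)
qed

theorem mainTheorem1:
  fixes p :: nat and \<alpha> \<beta> \<iota> :: real
  assumes "p \<ge> 1" and "\<alpha> > -1" and "\<beta> > -1"
    and "\<iota> * real p * (real p + 1) + (real p + \<alpha> + 1) * (real p + \<alpha>) * coeff_A \<alpha> \<beta> p \<noteq> 0"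
    and "\<iota> * real p * (real p + 1) + (real p + \<beta> + 1) * (real p + \<beta>) * coeff_A \<alpha> \<beta> p \<noteq> 0"
    and "kappa \<iota> \<alpha> \<beta> p \<noteq> 0" and "kappa \<iota> \<beta> \<alpha> p \<noteq> 0"
  shows "poly (h_L \<iota> \<alpha> \<beta> p) (-1) = 1 \<and> poly (h_L \<iota> \<alpha> \<beta> p) 1 = 0 \<and>
    poly (h_R \<iota> \<alpha> \<beta> p) (-1) = 0 \<and> poly (h_R \<iota> \<alpha> \<beta> p) 1 = 1 \<and>
    (\<forall>u :: real poly. degree u \<le> p \<longrightarrow>
      (\<forall>h \<in> {h_L \<iota> \<alpha> \<beta> p, h_R \<iota> \<alpha> \<beta> p}. \<forall>\<xi> \<eta> :: real.
        (LINT x:{-1<..<1}|lborel. poly h x * poly (pderiv u) x * jacobi_weight \<alpha> \<beta> x)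
        - \<iota> * poly ((pderiv ^^ p) u) \<xi> * poly ((pderiv ^^ (p + 1)) h) \<eta>
            * (LINT x:{-1<..<1}|lborel. jacobi_weight \<alpha> \<beta> x) = 0))"
proof -
  define A where "A = coeff_A \<alpha> \<beta> p"
  define Da where "Da = \<iota> * real p * (real p + 1) + (real p + \<alpha> + 1) * (real p + \<alpha>) * A"
  define Db where "Db = \<iota> * real p * (real p + 1) + (real p + \<beta> + 1) * (real p + \<beta>) * A"
  \<comment> \<open>\<open>P \<alpha> n\<close> is the value of J_n at 1, and
    \<open>P \<beta> n\<close> is its value at -1 up to the sign \<open>(-1) ^ n\<close>.\<close>
  define P where "P \<gamma> n = pochhammer (\<gamma> + 1) n / fact n" for \<gamma> :: real and n
  have D: "Da \<noteq> 0" "Db \<noteq> 0"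
    using assms(4,5) by (simp_all add: Da_def Db_def A_def)
  have pab: "real p + \<alpha> \<noteq> 0" "real p + \<beta> \<noteq> 0"
    using assms(1-3) by auto
  have D': "\<iota> * real p * (real p + 1) + (real p + \<alpha>) * (real p + \<alpha> + 1) * A = Da"
    "\<iota> * real p * (real p + 1) + (real p + \<beta>) * (real p + \<beta> + 1) * A = Db"
    by (simp_all add: Da_def Db_def mult_ac)
  have A': "coeff_A \<beta> \<alpha> p = A"
    using coeff_A_commute[OF assms(2,3)] by (simp add: A_def)
  \<comment> \<open>The correction term at an endpoint, up to sign: \<gamma> selects
    \<open>h_L\<close> (\<alpha>) or \<open>h_R\<close> (\<beta>), and \<delta> selects the endpoint
    1 (\<alpha>) or -1 (\<beta>).\<close>
  define S where "S \<gamma> \<delta> D = 1 / D * (\<iota> * (real p + 1) * (real p + \<gamma>) * P \<delta> (p - 1)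
      + (real p + 1) * (real p + \<gamma>) * A * P \<delta> (p + 1))" for \<gamma> \<delta> D
  have Saa: "S \<alpha> \<alpha> Da = P \<alpha> p" and Sbb: "S \<beta> \<beta> Db = P \<beta> p"
    using boundary_bracket[OF assms(1) pab(1) pab(1), of \<iota> A] boundary_bracket[OF assms(1) pab(2) pab(2), of \<iota> A] D pab
    unfolding D' Da_def[symmetric] Db_def[symmetric] P_def[symmetric] S_def by simp_all
  have Kab: "P \<beta> p + S \<alpha> \<beta> Da = kappa \<iota> \<alpha> \<beta> p" and Kba: "P \<alpha> p + S \<beta> \<alpha> Db = kappa \<iota> \<beta> \<alpha> p"
    using boundary_bracket[OF assms(1) pab, of \<iota> A] boundary_bracket[OF assms(1) pab(2,1), of \<iota> A] D
    unfolding kappa_def A' A_def[symmetric] D' Da_def[symmetric] Db_def[symmetric] P_def[symmetric] S_def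
    by (simp_all add: distrib_left)
  have J1: "poly (jacobi_poly \<alpha> \<beta> n) 1 = P \<alpha> n" for n
    by (simp add: poly_jacobi_poly_1 P_def)
  have Jm: "poly (jacobi_poly \<alpha> \<beta> n) (-1) = (-1) ^ n * P \<beta> n" for n
    by (simp add: poly_jacobi_poly_minus_1 assms P_def)
  \<comment> \<open>At -1 both neighbours of J_p carry the sign opposite to that of J_p, so the
    correction is added in \<open>h_L\<close> and subtracted in \<open>h_R\<close> there.\<close>
  have sgn: "(-1::real) ^ (p - 1) = - ((-1) ^ p)" "(-1::real) ^ (p + 1) = - ((-1) ^ p)"
    using assms(1) by (cases p; simp)+
  have sq: "(-1::real) ^ p * (-1) ^ p = 1"
    by (simp flip: power_mult_distrib)
  have hL: "poly (h_L \<iota> \<alpha> \<beta> p) x = (-1) ^ p / kappa \<iota> \<alpha> \<beta> p * (poly (jacobi_poly \<alpha> \<beta> p) x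
      - 1 / Da * (\<iota> * (real p + 1) * (real p + \<alpha>) * poly (jacobi_poly \<alpha> \<beta> (p - 1)) x
      + (real p + 1) * (real p + \<alpha>) * A * poly (jacobi_poly \<alpha> \<beta> (p + 1)) x))" for x
    unfolding h_L_def A_def[symmetric] Da_def[symmetric] by simp
  have hR: "poly (h_R \<iota> \<alpha> \<beta> p) x = 1 / kappa \<iota> \<beta> \<alpha> p * (poly (jacobi_poly \<alpha> \<beta> p) x
      + 1 / Db * (\<iota> * (real p + 1) * (real p + \<beta>) * poly (jacobi_poly \<alpha> \<beta> (p - 1)) x
      + (real p + 1) * (real p + \<beta>) * A * poly (jacobi_poly \<alpha> \<beta> (p + 1)) x))" for x
    unfolding h_R_def A_def[symmetric] Db_def[symmetric] by simp
  have "poly (h_L \<iota> \<alpha> \<beta> p) (-1) = (-1) ^ p * (-1) ^ p / kappa \<iota> \<alpha> \<beta> p * (P \<beta> p + S \<alpha> \<beta> Da)"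
    unfolding hL Jm sgn S_def by (simp add: algebra_simps diff_divide_distrib add_divide_distrib)
  then have 1: "poly (h_L \<iota> \<alpha> \<beta> p) (-1) = 1"
    using assms(6) by (simp add: Kab sq)
  have 2: "poly (h_L \<iota> \<alpha> \<beta> p) 1 = 0"
    unfolding hL J1 using Saa unfolding S_def by simp
  have "poly (h_R \<iota> \<alpha> \<beta> p) (-1) = (-1) ^ p / kappa \<iota> \<beta> \<alpha> p * (P \<beta> p - S \<beta> \<beta> Db)"
    unfolding hR Jm sgn S_def by (simp add: algebra_simps diff_divide_distrib add_divide_distrib)
  then have 3: "poly (h_R \<iota> \<alpha> \<beta> p) (-1) = 0"
    by (simp add: Sbb)
  have "poly (h_R \<iota> \<alpha> \<beta> p) 1 = 1 / kappa \<iota> \<beta> \<alpha> p * (P \<alpha> p + S \<beta> \<alpha> Db)"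
    unfolding hR J1 S_def by simp
  then have 4: "poly (h_R \<iota> \<alpha> \<beta> p) 1 = 1"
    using assms(7) by (simp add: Kba)
  \<comment> \<open>The minus sign of \<open>h_L\<close> is absorbed into the scalar
    \<open>d\<close> to fit the common form.\<close>
  have L: "h_L \<iota> \<alpha> \<beta> p = smult ((-1) ^ p / kappa \<iota> \<alpha> \<beta> p) (jacobi_poly \<alpha> \<beta> p
      + smult (- (1 / Da)) (smult (\<iota> * ((real p + 1) * (real p + \<alpha>))) (jacobi_poly \<alpha> \<beta> (p - 1))
      + smult ((real p + 1) * (real p + \<alpha>) * coeff_A \<alpha> \<beta> p) (jacobi_poly \<alpha> \<beta> (p + 1))))"
    unfolding h_L_def Da_def A_def by (simp only: smult_minus_left diff_conv_add_uminus mult.assoc)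
  have R: "h_R \<iota> \<alpha> \<beta> p = smult (1 / kappa \<iota> \<beta> \<alpha> p) (jacobi_poly \<alpha> \<beta> p
      + smult (1 / Db) (smult (\<iota> * ((real p + 1) * (real p + \<beta>))) (jacobi_poly \<alpha> \<beta> (p - 1))
      + smult ((real p + 1) * (real p + \<beta>) * coeff_A \<alpha> \<beta> p) (jacobi_poly \<alpha> \<beta> (p + 1))))"
    unfolding h_R_def Db_def A_def by (simp only: mult.assoc)
  show ?thesis
    using 1 2 3 4 jacobi_correction_identity[OF assms(1-3)] unfolding L R by blast
qed

end
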